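(* Let $F$ be a field of characteristic not $2$, let $K/F$ be a finite field extension, let $\sigma\in\mathrm{Aut}_F(K)$ be non-trivial and let $c\in K^{\times}$. Then there are exactly $2\,|J(c)\cap C(\sigma)|$ $F$-algebra automorphisms of $D(K,\sigma,c)$, each of which is given by $$G(x,y)=(\tau(x),\tau(y)b_i)\qquad(x,y\in K)$$ for each $\tau\in J(c)\cap C(\sigma)$, where $b_1,b_2\in K^{\times}$ are chosen such that $\sigma(b_1),\sigma(b_2)$ are the two solutions of $X^2-\tau(c)c^{-1}=0$ in $K$, and $i=1,2$.
   Context: $D(K,\sigma,c)$ denotes the $F$-vector space $K\oplus K$ with multiplication $(u,v)(x,y)=(ux+c\,\sigma(vy),\,uy+vx)$ for $u,v,x,y\in K$; it is a unital commutative, not necessarily associative, $F$-algebra. $J(c)=\{\tau\in\mathrm{Aut}_F(K)\mid X^2-\tau(c)c^{-1}\text{ has solutions in }K\}$, which is a subgroup of $\mathrm{Aut}_F(K)$, and $C(\sigma)=\{\tau\in\mathrm{Aut}_F(K)\mid\tau\circ\sigma=\sigma\circ\tau\}$ is the centralizer of $\sigma$ in $\mathrm{Aut}_F(K)$. *)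

theory Defs
  imports "HOL-Analysis.Analysis"
begin

text \<open>
  A field extension \<open>K/F\<close> is an embedding of the field \<open>'f\<close> into the field \<open>'k\<close>
  (a unital ring homomorphism between fields is injective).
\<close>

locale field_extension =
  fixes emb :: "'f::field \<Rightarrow> 'k::field"
  assumes emb_add: "emb (a + b) = emb a + emb b"
    and emb_mult: "emb (a * b) = emb a * emb b"
    and emb_one: "emb 1 = 1"

definition ext_scale :: "('f::field \<Rightarrow> 'k::field) \<Rightarrow> 'f \<Rightarrow> 'k \<Rightarrow> 'k"
  where "ext_scale emb a x = emb a * x"

lemma (in field_extension) vector_space_ext_scale: "vector_space (ext_scale emb)"
  by unfold_locales
    (simp_all add: ext_scale_def emb_add emb_mult emb_one algebra_simps)

locale finite_field_extension = field_extension +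
  assumes finite_dimensional: "\<exists>B. finite_dimensional_vector_space (ext_scale emb) B"

text \<open>
  A not necessarily associative algebra over \<open>'f\<close> is given by its scalar multiplication \<open>s\<close>
  and its product \<open>m\<close>. Automorphisms of a unital algebra fix the identity automatically,
  because they are surjective and multiplicative.
\<close>

definition algebra_aut ::
  "('f::field \<Rightarrow> 'a::ab_group_add \<Rightarrow> 'a) \<Rightarrow> ('a \<Rightarrow> 'a \<Rightarrow> 'a) \<Rightarrow> ('a \<Rightarrow> 'a) set"
  where "algebra_aut s m =
    {G. bij G \<and> Vector_Spaces.linear s s G \<and> (\<forall>x y. G (m x y) = m (G x) (G y))}"

definition field_aut :: "('f::field \<Rightarrow> 'k::field) \<Rightarrow> ('k \<Rightarrow> 'k) set"
  where "field_aut emb = algebra_aut (ext_scale emb) (*)"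

definition dickson_mult ::
  "('k::field \<Rightarrow> 'k) \<Rightarrow> 'k \<Rightarrow> 'k \<times> 'k \<Rightarrow> 'k \<times> 'k \<Rightarrow> 'k \<times> 'k"
  where "dickson_mult \<sigma> c = (\<lambda>(u, v) (x, y). (u * x + c * \<sigma> (v * y), u * y + v * x))"

definition dickson_scale :: "('f::field \<Rightarrow> 'k::field) \<Rightarrow> 'f \<Rightarrow> 'k \<times> 'k \<Rightarrow> 'k \<times> 'k"
  where "dickson_scale emb = module_prod.scale (ext_scale emb) (ext_scale emb)"

definition dickson_aut ::
  "('f::field \<Rightarrow> 'k::field) \<Rightarrow> ('k \<Rightarrow> 'k) \<Rightarrow> 'k \<Rightarrow> ('k \<times> 'k \<Rightarrow> 'k \<times> 'k) set"
  where "dickson_aut emb \<sigma> c = algebra_aut (dickson_scale emb) (dickson_mult \<sigma> c)"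

lemma (in field_extension) dickson_scale_pair:
  "dickson_scale emb a (x, y) = (emb a * x, emb a * y)"
proof -
  interpret K: vector_space "ext_scale emb" by (rule vector_space_ext_scale)
  interpret D: vector_space_prod "ext_scale emb" "ext_scale emb" ..
  show ?thesis by (simp add: dickson_scale_def D.scale_prod ext_scale_def)
qed

lemma (in field_extension) vector_space_dickson_scale: "vector_space (dickson_scale emb)"
  by unfold_locales
    (auto simp: dickson_scale_pair emb_add emb_mult emb_one algebra_simps)

definition J_group :: "('f::field \<Rightarrow> 'k::field) \<Rightarrow> 'k \<Rightarrow> ('k \<Rightarrow> 'k) set"
  where "J_group emb c = {\<tau> \<in> field_aut emb. \<exists>X. X\<^sup>2 - \<tau> c * inverse c = 0}"

definition C_group :: "('f::field \<Rightarrow> 'k::field) \<Rightarrow> ('k \<Rightarrow> 'k) \<Rightarrow> ('k \<Rightarrow> 'k) set"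
  where "C_group emb \<sigma> = {\<tau> \<in> field_aut emb. \<tau> \<circ> \<sigma> = \<sigma> \<circ> \<tau>}"

definition root_pair :: "('k::field \<Rightarrow> 'k) \<Rightarrow> 'k \<Rightarrow> ('k \<Rightarrow> 'k) \<Rightarrow> 'k \<Rightarrow> 'k \<Rightarrow> bool"
  where "root_pair \<sigma> c \<tau> b1 b2 \<longleftrightarrow>
    b1 \<noteq> 0 \<and> b2 \<noteq> 0 \<and> \<sigma> b1 \<noteq> \<sigma> b2 \<and> {X. X\<^sup>2 - \<tau> c * inverse c = 0} = {\<sigma> b1, \<sigma> b2}"

end

theory Submission
  imports Defs
begin

text \<open>
  Since \<open>\<sigma>\<close> is non-trivial, the middle nucleus of \<open>D(K,\<sigma>,c)\<close> is \<open>K \<oplus> 0\<close>, so an automorphism \<open>G\<close>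
  restricts to some \<open>\<tau> \<in> Aut\<^sub>F(K)\<close> there. With \<open>G(0,1) = (a,b)\<close>, squaring \<open>(0,1)\<close> gives
  \<open>(a\<^sup>2 + c \<sigma>(b\<^sup>2), 2ab) = (\<tau>(c), 0)\<close>. Surjectivity forces \<open>b \<noteq> 0\<close>, hence \<open>a = 0\<close> and
  \<open>\<sigma>(b)\<^sup>2 = \<tau>(c) c\<^sup>-\<^sup>1\<close>; applying \<open>G\<close> to \<open>(0,1)(0,y) = (c \<sigma>(y), 0)\<close> then gives \<open>\<tau> \<sigma> = \<sigma> \<tau>\<close>.
\<close>

section \<open>The embedding of F and the F-automorphisms of K\<close>

context field_extension
begin

lemma emb_zero: "emb 0 = 0"
  using emb_add[of 0 0] by (metis add_cancel_right_right add_0)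

lemma emb_eq_0_iff: "emb a = 0 \<longleftrightarrow> a = 0"
proof
  assume "emb a = 0"
  then have "emb (a * inverse a) = 0" by (simp add: emb_mult)
  then show "a = 0" using emb_one by (cases "a = 0") auto
qed (simp add: emb_zero)

text \<open>Since \<open>emb\<close> has trivial kernel, 2 = 0 in K would give 2 = 0 in F, so the
  characteristic of F would divide 2; as it is never 1, it would be 2.\<close>

lemma two_neq_0:
  assumes "CHAR('f) \<noteq> 2"
  shows "(2 :: 'k) \<noteq> 0"
proof
  assume "(2 :: 'k) = 0"
  moreover have "emb 2 = 2"
    using emb_add[of 1 1] by (simp add: emb_one)
  ultimately have "of_nat 2 = (0 :: 'f)" using emb_eq_0_iff[of 2] by simp
  then have "CHAR('f) dvd 2" by (simp only: of_nat_eq_0_iff_char_dvd)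
  then have "CHAR('f) = 1 \<or> CHAR('f) = 2"
    using two_is_prime_nat prime_nat_iff by blast
  then show False using assms CHAR_not_1 by auto
qed

text \<open>\<open>Vector_Spaces.linear\<close> also asserts that source and target are vector
  spaces; supplying that fact once leaves only the equational conditions.\<close>

lemma mem_field_aut_iff:
  "\<tau> \<in> field_aut emb \<longleftrightarrow> bij \<tau> \<and> (\<forall>x y. \<tau> (x + y) = \<tau> x + \<tau> y) \<and>
    (\<forall>a x. \<tau> (emb a * x) = emb a * \<tau> x) \<and> (\<forall>x y. \<tau> (x * y) = \<tau> x * \<tau> y)"
  using vector_space_ext_scale
  by (auto simp: field_aut_def algebra_aut_def Vector_Spaces.linear_iff ext_scale_def)

lemma mem_dickson_aut_iff:
  "G \<in> dickson_aut emb \<sigma> c \<longleftrightarrow> bij G \<and> (\<forall>p q. G (p + q) = G p + G q) \<and>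
    (\<forall>a p. G (dickson_scale emb a p) = dickson_scale emb a (G p)) \<and>
    (\<forall>p q. G (dickson_mult \<sigma> c p q) = dickson_mult \<sigma> c (G p) (G q))"
  using vector_space_dickson_scale
  by (auto simp: dickson_aut_def algebra_aut_def Vector_Spaces.linear_iff)

context
  fixes \<tau> :: "'k \<Rightarrow> 'k"
  assumes \<tau>: "\<tau> \<in> field_aut emb"
begin

lemma field_aut_bij: "bij \<tau>"
  and field_aut_add: "\<tau> (x + y) = \<tau> x + \<tau> y"
  and field_aut_mult: "\<tau> (x * y) = \<tau> x * \<tau> y"
  and field_aut_scale: "\<tau> (emb a * x) = emb a * \<tau> x"
  using \<tau> by (auto simp: mem_field_aut_iff)

lemma field_aut_zero: "\<tau> 0 = 0"
  using field_aut_add[of 0 0] by (metis add_cancel_right_right add_0)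

lemma field_aut_eq_iff: "\<tau> x = \<tau> y \<longleftrightarrow> x = y"
  using field_aut_bij by (auto simp: bij_def inj_eq)

lemma field_aut_eq_0_iff: "\<tau> x = 0 \<longleftrightarrow> x = 0"
  using field_aut_eq_iff[of x 0] by (simp add: field_aut_zero)

text \<open>The image of 1 is idempotent, and nonzero by injectivity, so cancellation in K makes it
  1.\<close>

lemma field_aut_one: "\<tau> 1 = 1"
  using field_aut_mult[of 1 1] field_aut_eq_0_iff[of 1] by simp

lemma field_aut_emb: "\<tau> (emb a) = emb a"
  using field_aut_scale[of a 1] by (simp add: field_aut_one)

lemma field_aut_uminus: "\<tau> (- x) = - \<tau> x"
  using field_aut_add[of x "- x"] by (simp add: field_aut_zero eq_neg_iff_add_eq_0 add.commute)

lemma field_aut_power: "\<tau> (x ^ n) = \<tau> x ^ n"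
  by (induction n) (auto simp: field_aut_one field_aut_mult)

lemma field_aut_sum: "\<tau> (sum f A) = (\<Sum>x\<in>A. \<tau> (f x))"
  by (induction A rule: infinite_finite_induct) (auto simp: field_aut_zero field_aut_add)

text \<open>Automorphisms fix F pointwise, hence the coefficients. In particular they permute the
  roots of such a polynomial, which bounds the possible images of an element.\<close>

lemma field_aut_poly:
  assumes "\<And>i. coeff p i \<in> range emb"
  shows "\<tau> (poly p x) = poly p (\<tau> x)"
proof -
  have "\<tau> (coeff p i) = coeff p i" for i
    using assms[of i] by (auto simp: field_aut_emb)
  then show ?thesis
    by (simp add: poly_altdef field_aut_sum field_aut_mult field_aut_power)
qed

end

end

section \<open>Finiteness of the automorphism group of K/F\<close>

context finite_field_extension
begin

text \<open>Linear dependence concerns the set of powers of \<open>x\<close> and so misses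
  repetitions. A repeated power gives the polynomial X^i - X^j directly; otherwise the powers form
  an infinite set, which is dependent by finite dimension.\<close>

lemma algebraic:
  obtains p where "p \<noteq> 0" "\<And>i. coeff p i \<in> range emb" "poly p x = 0"
proof (cases "inj (\<lambda>i :: nat. x ^ i)")
  case False
  then obtain i j :: nat where ij: "i \<noteq> j" "x ^ i = x ^ j"
    by (auto simp: inj_def)
  define p where "p = monom (emb 1) i - monom (emb 1) j"
  have "emb (- 1) = - 1"
    using emb_add[of 1 "- 1"] by (simp add: emb_zero emb_one eq_neg_iff_add_eq_0 add.commute)
  then have "{0, 1, - 1} \<subseteq> range emb"
    using emb_zero emb_one by (metis insert_subset empty_subsetI rangeI)
  then have "coeff p k \<in> range emb" for k
    by (auto simp: p_def emb_one)
  moreover have "coeff p i \<noteq> 0" using ij by (simp add: p_def emb_one)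
  then have "p \<noteq> 0" by auto
  moreover have "poly p x = 0" using ij by (simp add: p_def poly_monom)
  ultimately show thesis using that by blast
next
  case True
  obtain B where "finite_dimensional_vector_space (ext_scale emb) B"
    using finite_dimensional by blast
  then interpret V: finite_dimensional_vector_space "ext_scale emb" B .
  have "infinite (range (\<lambda>i :: nat. x ^ i))"
    using True finite_imageD by blast
  then have "V.dependent (range (\<lambda>i :: nat. x ^ i))"
    using V.finiteI_independent by blast
  then obtain U u v where U: "finite U" "U \<subseteq> range (\<lambda>i :: nat. x ^ i)"
    "(\<Sum>v\<in>U. ext_scale emb (u v) v) = 0" "v \<in> U" "u v \<noteq> 0"
    by (auto simp: V.dependent_explicit)
  obtain I where I: "U = (\<lambda>i. x ^ i) ` I"
    using U(2) by (auto simp: subset_image_iff)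
  \<comment> \<open>Distinct exponents give distinct powers, so the dependence relation can be
    reindexed by exponents and read as a polynomial.\<close>
  have inj: "inj_on (\<lambda>i. x ^ i) I" using True inj_on_subset by blast
  have fin: "finite I" using U(1) inj I finite_imageD by blast
  obtain k where k: "k \<in> I" "v = x ^ k" using U(4) I by auto
  define p where "p = (\<Sum>i\<in>I. monom (emb (u (x ^ i))) i)"
  have coeff_p: "coeff p i = (if i \<in> I then emb (u (x ^ i)) else 0)" for i
    using fin by (simp add: p_def coeff_sum)
  then have "coeff p i \<in> range emb" for i
    using emb_zero by (metis rangeI)
  moreover have "coeff p k \<noteq> 0"
    using k U(5) by (simp add: coeff_p emb_eq_0_iff)
  then have "p \<noteq> 0" by auto
  moreover have "poly p x = 0"
    using U(3) unfolding I sum.reindex[OF inj]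
    by (simp add: p_def poly_sum poly_monom ext_scale_def o_def)
  ultimately show thesis using that by blast
qed

text \<open>An automorphism is determined by its values on a finite spanning set, and each such value is
  a root of a fixed nonzero polynomial over \<open>F\<close>.\<close>

lemma finite_field_aut: "finite (field_aut emb)"
proof -
  obtain B where "finite_dimensional_vector_space (ext_scale emb) B"
    using finite_dimensional by blast
  then interpret V: finite_dimensional_vector_space "ext_scale emb" B .
  have "\<forall>x. \<exists>p. p \<noteq> 0 \<and> (\<forall>i. coeff p i \<in> range emb) \<and> poly p x = 0"
    using algebraic by metis
  then obtain P where P: "\<And>x. P x \<noteq> 0" "\<And>x i. coeff (P x) i \<in> range emb" "\<And>x. poly (P x) x = 0"
    by metis
  let ?R = "Pi\<^sub>E B (\<lambda>x. {y. poly (P x) y = 0})"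
  have "finite ?R"
    using V.finite_Basis P(1) poly_roots_finite by (intro finite_PiE) auto
  moreover have "(\<lambda>\<tau>. restrict \<tau> B) ` field_aut emb \<subseteq> ?R"
  proof (clarsimp)
    fix \<tau> x assume "\<tau> \<in> field_aut emb" "x \<in> B"
    then show "poly (P x) (\<tau> x) = 0"
      using field_aut_poly[of \<tau> "P x" x] P by (simp add: field_aut_zero)
  qed
  ultimately have "finite ((\<lambda>\<tau>. restrict \<tau> B) ` field_aut emb)"
    by (rule finite_subset[rotated])
  moreover have "inj_on (\<lambda>\<tau>. restrict \<tau> B) (field_aut emb)"
  proof (rule inj_onI, rule ext)
    fix \<tau> \<tau>' x
    assume \<tau>: "\<tau> \<in> field_aut emb" "\<tau>' \<in> field_aut emb" and eq: "restrict \<tau> B = restrict \<tau>' B"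
    have "x \<in> V.span B" by (simp add: V.span_Basis)
    then show "\<tau> x = \<tau>' x"
    proof (induction rule: V.span_induct_alt)
      case base
      then show ?case using \<tau> by (simp add: field_aut_zero)
    next
      case (step a y z)
      have "\<tau> y = \<tau>' y" using eq step(1) by (metis restrict_apply')
      then show ?case
        using step \<tau> by (simp add: ext_scale_def field_aut_add field_aut_scale)
    qed
  qed
  ultimately show ?thesis using finite_imageD by blast
qed

end

section \<open>The middle nucleus and the form of the automorphisms of D(K,\<sigma>,c)\<close>

definition middle_nucleus :: "('a \<Rightarrow> 'a \<Rightarrow> 'a) \<Rightarrow> 'a set"
  where "middle_nucleus m = {a. \<forall>x y. m (m x a) y = m x (m a y)}"

text \<open>Surjectivity lets the test elements be taken as images under \<open>G\<close>, and
  injectivity removes \<open>G\<close> again. Both directions matter later: one restricts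
  \<open>G\<close> to K, the other makes that restriction onto and keeps (0,1) out of the
  nucleus.\<close>

lemma middle_nucleus_image:
  assumes "bij G" and hom: "\<And>x y. G (m x y) = m (G x) (G y)"
  shows "G a \<in> middle_nucleus m \<longleftrightarrow> a \<in> middle_nucleus m"
proof -
  have "G a \<in> middle_nucleus m \<longleftrightarrow> (\<forall>x y. m (m (G x) (G a)) (G y) = m (G x) (m (G a) (G y)))"
    unfolding middle_nucleus_def using bij_is_surj[OF \<open>bij G\<close>] by (auto dest: surjD) (metis surj_def)
  also have "\<dots> \<longleftrightarrow> (\<forall>x y. G (m (m x a) y) = G (m x (m a y)))"
    by (simp add: hom)
  also have "\<dots> \<longleftrightarrow> a \<in> middle_nucleus m"
    using \<open>bij G\<close> by (simp add: middle_nucleus_def bij_def inj_eq)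
  finally show ?thesis .
qed

text \<open>The characteristic enters as 2 \<noteq> 0 in K, the form that cancels the 2 in 2ab = 0
  and separates a square root from its negative.\<close>

locale dickson_extension = finite_field_extension emb
  for emb :: "'a::field \<Rightarrow> 'b::field" +
  fixes \<sigma> :: "'b \<Rightarrow> 'b" and c :: 'b
  assumes two_neq_0: "(2 :: 'b) \<noteq> 0"
    and \<sigma>: "\<sigma> \<in> field_aut emb" and \<sigma>_neq_id: "\<sigma> \<noteq> id" and c_neq_0: "c \<noteq> 0"
begin

abbreviation "S \<equiv> J_group emb c \<inter> C_group emb \<sigma>"

abbreviation lift :: "('b \<Rightarrow> 'b) \<Rightarrow> 'b \<Rightarrow> 'b \<times> 'b \<Rightarrow> 'b \<times> 'b"
  where "lift \<tau> b \<equiv> \<lambda>(x, y). (\<tau> x, \<tau> y * b)"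

lemmas \<sigma>_simps = field_aut_zero[OF \<sigma>] field_aut_one[OF \<sigma>] field_aut_mult[OF \<sigma>]
  field_aut_add[OF \<sigma>] field_aut_uminus[OF \<sigma>]

lemma square_eq_iff: "X\<^sup>2 - \<tau> c * inverse c = 0 \<longleftrightarrow> c * X\<^sup>2 = \<tau> c"
  using c_neq_0 by (auto simp: field_simps)

lemma mem_S_iff:
  "\<tau> \<in> S \<longleftrightarrow> \<tau> \<in> field_aut emb \<and> (\<exists>X. c * X\<^sup>2 = \<tau> c) \<and> (\<forall>x. \<tau> (\<sigma> x) = \<sigma> (\<tau> x))"
  unfolding J_group_def C_group_def square_eq_iff by (auto simp: fun_eq_iff)

lemma middle_nucleus_dickson: "middle_nucleus (dickson_mult \<sigma> c) = UNIV \<times> {0}"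
proof (intro equalityI subsetI)
  fix p assume "p \<in> middle_nucleus (dickson_mult \<sigma> c)"
  moreover obtain a b where p: "p = (a, b)" by fastforce
  \<comment> \<open>Testing the nucleus condition on (0,1) and (x,0) compares the first components c
    \<sigma>(b) x and c \<sigma>(b x); an x moved by \<sigma> then forces \<sigma>(b) = 0.\<close>
  ultimately have *: "dickson_mult \<sigma> c (dickson_mult \<sigma> c (0, 1) (a, b)) (x, 0) =
      dickson_mult \<sigma> c (0, 1) (dickson_mult \<sigma> c (a, b) (x, 0))" for x
    by (simp add: middle_nucleus_def)
  have "\<sigma> b * x = \<sigma> b * \<sigma> x" for x
    using *[of x] c_neq_0 by (simp add: dickson_mult_def \<sigma>_simps mult_ac)
  then have "b = 0"
    using \<sigma>_neq_id field_aut_eq_0_iff[OF \<sigma>, of b] by (auto simp: fun_eq_iff)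
  then show "p \<in> UNIV \<times> {0}" by (simp add: p)
next
  fix p :: "'b \<times> 'b" assume "p \<in> UNIV \<times> {0}"
  then show "p \<in> middle_nucleus (dickson_mult \<sigma> c)"
    by (auto simp: middle_nucleus_def dickson_mult_def \<sigma>_simps algebra_simps)
qed

text \<open>In a product of two images, the twisted term is c \<sigma>(b)^2 \<sigma>(\<tau>(vy)).
  The root condition turns its factor into \<tau>(c), and commutation turns the rest into
  \<tau>(\<sigma>(vy)).\<close>

lemma lift_mem_dickson_aut:
  assumes \<tau>: "\<tau> \<in> field_aut emb" "\<And>x. \<tau> (\<sigma> x) = \<sigma> (\<tau> x)" and b: "c * (\<sigma> b)\<^sup>2 = \<tau> c"
  shows "lift \<tau> b \<in> dickson_aut emb \<sigma> c"
proof -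
  have "\<tau> c \<noteq> 0" using c_neq_0 field_aut_eq_0_iff[OF \<tau>(1)] by simp
  then have b0: "b \<noteq> 0" using b \<sigma>_simps by auto
  have "inj (lift \<tau> b)"
    using b0 by (auto simp: inj_def field_aut_eq_iff[OF \<tau>(1)])
  moreover have "surj (lift \<tau> b)"
  proof (rule surjI)
    fix p :: "'b \<times> 'b"
    show "lift \<tau> b (inv \<tau> (fst p), inv \<tau> (snd p / b)) = p"
      using b0 surj_f_inv_f[OF bij_is_surj[OF field_aut_bij[OF \<tau>(1)]]] by simp
  qed
  ultimately show ?thesis
    unfolding mem_dickson_aut_iff bij_def
    by (auto simp: dickson_mult_def dickson_scale_pair \<sigma>_simps field_aut_add[OF \<tau>(1)]
        field_aut_mult[OF \<tau>(1)] field_aut_emb[OF \<tau>(1)] \<tau>(2) b[symmetric]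
        power2_eq_square algebra_simps)
qed

lemma dickson_autE:
  assumes G: "G \<in> dickson_aut emb \<sigma> c"
  obtains \<tau> b where "\<tau> \<in> S" "c * (\<sigma> b)\<^sup>2 = \<tau> c" "G = lift \<tau> b"
proof -
  note G' = G[unfolded mem_dickson_aut_iff]
  have bij: "bij G" and add: "\<And>p q. G (p + q) = G p + G q"
    and scale: "\<And>a p. G (dickson_scale emb a p) = dickson_scale emb a (G p)"
    and mult: "\<And>p q. G (dickson_mult \<sigma> c p q) = dickson_mult \<sigma> c (G p) (G q)"
    using G' by auto
  have nuc: "snd (G p) = 0 \<longleftrightarrow> snd p = 0" for p
    using middle_nucleus_image[of G "dickson_mult \<sigma> c" p, OF bij mult]
    by (simp add: middle_nucleus_dickson mem_Times_iff)
  define \<tau> where "\<tau> = (\<lambda>x. fst (G (x, 0)))"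
  have G0: "G (x, 0) = (\<tau> x, 0)" for x
    using nuc[of "(x, 0)"] by (simp add: \<tau>_def prod_eq_iff)
  have "inj \<tau>"
    using bij_is_inj[OF bij] G0 by (metis (mono_tags, lifting) injI inj_eq prod.inject)
  moreover have "surj \<tau>"
  proof (unfold surj_def, rule allI)
    fix z
    \<comment> \<open>The preimage of a nucleus element lies in the nucleus, so it comes from
      K.\<close>
    obtain p where p: "G p = (z, 0)" using bij by (metis bij_pointE)
    then have "p = (fst p, 0)" using nuc[of p] by (simp add: prod_eq_iff)
    then show "\<exists>x. z = \<tau> x" using p G0 by (metis prod.inject)
  qed
  moreover have "\<tau> (x + y) = \<tau> x + \<tau> y" for x y
    using add[of "(x, 0)" "(y, 0)"] by (simp add: G0)
  moreover have "\<tau> (x * y) = \<tau> x * \<tau> y" for x y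
    using mult[of "(x, 0)" "(y, 0)"] by (simp add: G0 dickson_mult_def \<sigma>_simps)
  moreover have "\<tau> (emb a * x) = emb a * \<tau> x" for a x
    using scale[of a "(x, 0)"] by (simp add: G0 dickson_scale_pair)
  ultimately have \<tau>: "\<tau> \<in> field_aut emb"
    by (simp add: mem_field_aut_iff bij_def)
  obtain a b where ab: "G (0, 1) = (a, b)" by fastforce
  \<comment> \<open>(0,1) lies outside the middle nucleus, hence so does its image.\<close>
  have b0: "b \<noteq> 0" using nuc[of "(0, 1)"] ab by simp
  have "dickson_mult \<sigma> c (a, b) (a, b) = (\<tau> c, 0)"
    using mult[of "(0, 1)" "(0, 1)"] by (simp add: ab G0 dickson_mult_def \<sigma>_simps)
  then have sq: "a * a + c * (\<sigma> b)\<^sup>2 = \<tau> c" and "2 * (a * b) = 0"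
    by (auto simp: dickson_mult_def \<sigma>_simps power2_eq_square mult.commute)
  then have a0: "a = 0" using b0 two_neq_0 by simp
  \<comment> \<open>Uses the factorization (0,y) = (y,0)(0,1).\<close>
  have Gy: "G (0, y) = (0, \<tau> y * b)" for y
    using mult[of "(y, 0)" "(0, 1)"] by (simp add: ab a0 G0 dickson_mult_def \<sigma>_simps)
  have G_eq: "G = lift \<tau> b"
  proof (rule ext, clarify)
    fix x y show "G (x, y) = (\<tau> x, \<tau> y * b)"
      using add[of "(x, 0)" "(0, y)"] by (simp add: G0 Gy)
  qed
  have "\<tau> (\<sigma> y) = \<sigma> (\<tau> y)" for y
  proof -
    have "\<tau> c * \<tau> (\<sigma> y) = (c * (\<sigma> b)\<^sup>2) * \<sigma> (\<tau> y)"
      using mult[of "(0, 1)" "(0, y)"]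
      by (simp add: G0 Gy ab a0 dickson_mult_def \<sigma>_simps field_aut_mult[OF \<tau>]
          field_aut_one[OF \<tau>] power2_eq_square mult_ac)
    also have "c * (\<sigma> b)\<^sup>2 = \<tau> c" using sq a0 by simp
    finally show ?thesis using c_neq_0 by (simp add: field_aut_eq_0_iff[OF \<tau>])
  qed
  moreover have b_root: "c * (\<sigma> b)\<^sup>2 = \<tau> c" using sq a0 by simp
  ultimately have "\<tau> \<in> S" using \<tau> unfolding mem_S_iff by blast
  then show thesis using b_root G_eq by (rule that)
qed

section \<open>Root pairs and the count of automorphisms\<close>

lemma root_pair_exists:
  assumes "\<tau> \<in> S"
  shows "\<exists>b1 b2. root_pair \<sigma> c \<tau> b1 b2"
proof -
  obtain X where X: "c * X\<^sup>2 = \<tau> c" and \<tau>: "\<tau> \<in> field_aut emb"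
    using assms unfolding mem_S_iff by blast
  obtain b where b: "\<sigma> b = X" using field_aut_bij[OF \<sigma>] by (metis bij_pointE)
  have X0: "X \<noteq> 0"
    using X c_neq_0 field_aut_eq_0_iff[OF \<tau>, of c] by auto
  \<comment> \<open>X = -X would mean 2X = 0; this is where the two roots become distinct.\<close>
  then have "X \<noteq> - X"
    using two_neq_0 by (metis add_eq_0_iff mult_2 no_zero_divisors)
  moreover have "b \<noteq> 0" using X0 b \<sigma>_simps by auto
  moreover have "{Y. Y\<^sup>2 - \<tau> c * inverse c = 0} = {X, - X}"
    unfolding square_eq_iff unfolding X[symmetric] using c_neq_0 by (auto simp: power2_eq_iff)
  ultimately have "root_pair \<sigma> c \<tau> b (- b)"
    by (auto simp: root_pair_def b \<sigma>_simps)
  then show ?thesis by blast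
qed

text \<open>Injectivity of \<sigma> carries the root set back to \<open>b1\<close> and
  \<open>b2\<close>. Membership thus becomes an equation that does not depend on the chosen
  pair.\<close>

lemma root_pair_mem_iff:
  assumes "root_pair \<sigma> c \<tau> b1 b2"
  shows "b \<in> {b1, b2} \<longleftrightarrow> c * (\<sigma> b)\<^sup>2 = \<tau> c"
proof -
  have "b \<in> {b1, b2} \<longleftrightarrow> \<sigma> b \<in> {\<sigma> b1, \<sigma> b2}"
    by (simp add: field_aut_eq_iff[OF \<sigma>])
  also have "{\<sigma> b1, \<sigma> b2} = {X. X\<^sup>2 - \<tau> c * inverse c = 0}"
    using assms by (simp add: root_pair_def)
  finally show ?thesis unfolding mem_Collect_eq square_eq_iff .
qed

lemma dickson_aut_eq:
  assumes "\<forall>\<tau>\<in>S. root_pair \<sigma> c \<tau> (b1 \<tau>) (b2 \<tau>)"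
  shows "dickson_aut emb \<sigma> c = {lift \<tau> b | \<tau> b. \<tau> \<in> S \<and> b \<in> {b1 \<tau>, b2 \<tau>}}"
proof (intro equalityI subsetI)
  fix G assume "G \<in> dickson_aut emb \<sigma> c"
  then obtain \<tau> b where "\<tau> \<in> S" "c * (\<sigma> b)\<^sup>2 = \<tau> c" "G = lift \<tau> b"
    by (rule dickson_autE)
  then show "G \<in> {lift \<tau> b | \<tau> b. \<tau> \<in> S \<and> b \<in> {b1 \<tau>, b2 \<tau>}}"
    using assms root_pair_mem_iff by blast
next
  fix G assume "G \<in> {lift \<tau> b | \<tau> b. \<tau> \<in> S \<and> b \<in> {b1 \<tau>, b2 \<tau>}}"
  then obtain \<tau> b where *: "\<tau> \<in> S" "b \<in> {b1 \<tau>, b2 \<tau>}" "G = lift \<tau> b" by blast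
  then have "c * (\<sigma> b)\<^sup>2 = \<tau> c" using assms root_pair_mem_iff by blast
  then show "G \<in> dickson_aut emb \<sigma> c"
    using * lift_mem_dickson_aut unfolding mem_S_iff by blast
qed

lemma finite_S: "finite S"
  by (rule finite_subset[OF _ finite_field_aut]) (auto simp: J_group_def)

lemma finite_card_dickson_aut:
  "finite (dickson_aut emb \<sigma> c) \<and> card (dickson_aut emb \<sigma> c) = 2 * card S"
proof -
  obtain b1 b2 where b: "\<forall>\<tau>\<in>S. root_pair \<sigma> c \<tau> (b1 \<tau>) (b2 \<tau>)"
    using root_pair_exists by metis
  \<comment> \<open>The automorphisms are counted through the pairs (\<tau>, b): \<tau> is recovered
    from the values on K \<oplus> 0 and b from the value at (0,1).\<close>
  let ?T = "Sigma S (\<lambda>\<tau>. {b1 \<tau>, b2 \<tau>})"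
  have "dickson_aut emb \<sigma> c = (\<lambda>(\<tau>, b). lift \<tau> b) ` ?T"
    unfolding dickson_aut_eq[OF b] by force
  moreover have "inj_on (\<lambda>(\<tau>, b). lift \<tau> b) ?T"
  proof (rule inj_onI, clarify)
    fix \<tau> b \<tau>' b'
    assume "\<tau> \<in> J_group emb c" "\<tau>' \<in> J_group emb c" and eq: "lift \<tau> b = lift \<tau>' b'"
    then have \<tau>: "\<tau> \<in> field_aut emb" "\<tau>' \<in> field_aut emb"
      by (simp_all add: J_group_def)
    have "\<tau> x = \<tau>' x" for x using fun_cong[OF eq, of "(x, 0)"] by simp
    moreover have "b = b'"
      using fun_cong[OF eq, of "(0, 1)"] \<tau> by (simp add: field_aut_one)
    ultimately show "\<tau> = \<tau>' \<and> b = b'" by auto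
  qed
  moreover have "card {b1 \<tau>, b2 \<tau>} = 2" if "\<tau> \<in> S" for \<tau>
  proof -
    have "root_pair \<sigma> c \<tau> (b1 \<tau>) (b2 \<tau>)" using b that by blast
    then have "b1 \<tau> \<noteq> b2 \<tau>" by (auto simp: root_pair_def)
    then show ?thesis by simp
  qed
  \<comment> \<open>Finiteness of \<open>S\<close> turns the cardinality of the dependent sum into a
    sum of fibre sizes, each equal to 2.\<close>
  then have "card ?T = 2 * card S"
    using finite_S by simp
  moreover have "finite ?T" using finite_S by simp
  ultimately show ?thesis by (simp add: card_image)
qed

end

theorem theorem2p24:
  fixes emb :: "'f::field \<Rightarrow> 'k::field" and \<sigma> :: "'k \<Rightarrow> 'k" and c :: 'k
  assumes "CHAR('f) \<noteq> 2"
    and "finite_field_extension emb"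
    and "\<sigma> \<in> field_aut emb" and "\<sigma> \<noteq> id"
    and "c \<noteq> 0"
  shows "finite (J_group emb c \<inter> C_group emb \<sigma>) \<and>
    finite (dickson_aut emb \<sigma> c) \<and>
    card (dickson_aut emb \<sigma> c) = 2 * card (J_group emb c \<inter> C_group emb \<sigma>) \<and>
    (\<forall>\<tau> \<in> J_group emb c \<inter> C_group emb \<sigma>. \<exists>b1 b2. root_pair \<sigma> c \<tau> b1 b2) \<and>
    (\<forall>b1 b2. (\<forall>\<tau> \<in> J_group emb c \<inter> C_group emb \<sigma>. root_pair \<sigma> c \<tau> (b1 \<tau>) (b2 \<tau>)) \<longrightarrow>
      dickson_aut emb \<sigma> c =
        {(\<lambda>(x, y). (\<tau> x, \<tau> y * b)) | \<tau> b.
          \<tau> \<in> J_group emb c \<inter> C_group emb \<sigma> \<and> b \<in> {b1 \<tau>, b2 \<tau>}})"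
proof -
  interpret finite_field_extension emb by fact
  interpret dickson_extension emb \<sigma> c
    using assms two_neq_0 by unfold_locales auto
  show ?thesis
    using finite_S finite_card_dickson_aut root_pair_exists dickson_aut_eq by blast
qed

end
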